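(* Let $X$ be a compact metric space, let $f\colon X\to X$ be a continuous map, let $X^{\mathbb N}$ be the product space of infinitely many copies of $X$ (indexed by $n\ge 1$), and let $g=f^{\mathbb N}\colon X^{\mathbb N}\to X^{\mathbb N}$ be the map defined by: for any $u=(u_n)_{n\ge1},v=(v_n)_{n\ge1}\in X^{\mathbb N}$, $v=g(u)$ if and only if $v_n=f(u_n)$ for all $n\ge1$. Suppose that there are a closed subset $\Lambda$ of $X$ with $f(\Lambda)\subset\Lambda$, a point $p\in\Lambda$, and a point $z\in X$ such that (1) $\omega((p,z),f\times f)\cap\Delta\neq\emptyset$, where $\Delta=\{(x,y)\in X\times X\colon x=y\}$ and $f\times f\colon X\times X\to X\times X$ is the map $(x,y)\mapsto(f(x),f(y))$; (2) $\omega(z,f)\setminus\Lambda$ is an uncountable set; (3) $\omega(z,f)\setminus Per(f)\neq\emptyset$. Then $g$ is $\omega$-chaotic.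
   Context: For a compact metric (or compact metrizable) space $Z$, a continuous map $F\colon Z\to Z$ and $x\in Z$, the $\omega$-limit set $\omega(x,F)$ is the set of $y\in Z$ such that $\lim_{j\to\infty}F^{i_j}(x)=y$ for some $0\le i_1<i_2<\cdots$. The set of periodic points is $Per(F)=\bigcup_{j\ge1}\{x\in Z\colon F^j(x)=x\}$. A subset $S$ of $Z$ is an $\omega$-scrambled set for $F$ if for any $x,y\in S$ with $x\ne y$: (i) $\omega(x,F)\setminus\omega(y,F)$ is an uncountable set; (ii) $\omega(x,F)\cap\omega(y,F)\ne\emptyset$; (iii) $\omega(x,F)\setminus Per(F)\ne\emptyset$. The map $F$ is $\omega$-chaotic if there is an uncountable $\omega$-scrambled set for $F$. $X^{\mathbb N}$ and $X\times X$ carry the product topology, so they are compact metrizable. *)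

theory Defs
  imports "HOL-Analysis.Analysis"
begin

text \<open>
  A space is given as a carrier set Z (with the subspace topology) in an ambient topological
  type, and a self-map of Z is a function on that type that maps Z into Z; its values outside Z
  are irrelevant. Each \<^const>\<open>strict_mono\<close> sequence i below is the sequence of times
  i 0 < i 1 < ... along which the orbit converges.
\<close>

definition omega_limit_on ::
  "'a::topological_space set \<Rightarrow> ('a \<Rightarrow> 'a) \<Rightarrow> 'a \<Rightarrow> 'a set" where
  "omega_limit_on Z F x =
     {y \<in> Z. \<exists>i :: nat \<Rightarrow> nat. strict_mono i \<and> (\<lambda>j. (F ^^ i j) x) \<longlonglongrightarrow> y}"

definition periodic_points_on :: "'a set \<Rightarrow> ('a \<Rightarrow> 'a) \<Rightarrow> 'a set" where
  "periodic_points_on Z F = (\<Union>j\<in>{1..}. {x \<in> Z. (F ^^ j) x = x})"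

definition omega_scrambled_on ::
  "'a::topological_space set \<Rightarrow> ('a \<Rightarrow> 'a) \<Rightarrow> 'a set \<Rightarrow> bool" where
  "omega_scrambled_on Z F S \<longleftrightarrow> S \<subseteq> Z \<and>
     (\<forall>x\<in>S. \<forall>y\<in>S. x \<noteq> y \<longrightarrow>
        uncountable (omega_limit_on Z F x - omega_limit_on Z F y) \<and>
        omega_limit_on Z F x \<inter> omega_limit_on Z F y \<noteq> {} \<and>
        omega_limit_on Z F x - periodic_points_on Z F \<noteq> {})"

definition omega_chaotic_on ::
  "'a::topological_space set \<Rightarrow> ('a \<Rightarrow> 'a) \<Rightarrow> bool" where
  "omega_chaotic_on Z F \<longleftrightarrow> (\<exists>S. uncountable S \<and> omega_scrambled_on Z F S)"

text \<open>
  The countable power of X, with coordinates numbered from 0 instead of 1. The topology of the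
  function type \<^typ>\<open>nat \<Rightarrow> 'a::topological_space\<close> is the product topology.
\<close>

definition seq_power :: "'a set \<Rightarrow> (nat \<Rightarrow> 'a) set" where
  "seq_power X = (\<Pi> n\<in>UNIV. X)"

definition seq_power_map :: "('a \<Rightarrow> 'a) \<Rightarrow> (nat \<Rightarrow> 'a) \<Rightarrow> (nat \<Rightarrow> 'a)" where
  "seq_power_map f u = (\<lambda>n. f (u n))"

end

theory Submission
  imports Defs
begin

text \<open>
  For \<open>A \<subseteq> \<nat>\<close> take the point of the power with coordinates \<open>z\<close> on \<open>A\<close> and \<open>p\<close> off \<open>A\<close>.
  The orbits of all these points converge along the times of (1) to one constant sequence. If
  \<open>n \<in> A - B\<close>, the \<open>n\<close>-th coordinates of the \<open>\<omega>\<close>-limit points of the first point cover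
  \<open>\<omega>(z, f)\<close>, those of the second lie in \<open>\<Lambda>\<close>. So any uncountable antichain of subsets of
  \<open>\<nat>\<close> yields an \<open>\<omega>\<close>-scrambled set.
\<close>

lemma seq_power_map_funpow: "(seq_power_map f ^^ k) u = (\<lambda>n. (f ^^ k) (u n))"
  by (induction k) (simp_all add: seq_power_map_def)

lemma funpow_in:
  assumes "f ` S \<subseteq> S" "x \<in> S"
  shows "(f ^^ k) x \<in> S"
  using assms by (induction k) auto

text \<open>The function type carries the product topology, so convergence reduces to the
  coordinates.\<close>

lemma tendsto_fun_iff:
  fixes h :: "'i \<Rightarrow> 'b \<Rightarrow> 'a::topological_space"
  shows "(h \<longlongrightarrow> l) F \<longleftrightarrow> (\<forall>n. ((\<lambda>j. h j n) \<longlongrightarrow> l n) F)"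
  using limitin_componentwise[of "\<lambda>_. euclidean" UNIV h l F]
  by (simp add: euclidean_product_topology)

lemma omega_limit_on_coordinate:
  assumes "v \<in> omega_limit_on (seq_power X) (seq_power_map f) u"
  shows "v n \<in> omega_limit_on X f (u n)"
  using assms
  by (auto simp: omega_limit_on_def seq_power_def seq_power_map_funpow tendsto_fun_iff)

text \<open>A period of \<open>v\<close> is a period of every coordinate, so one coordinate that is
  not periodic already makes \<open>v\<close> not periodic.\<close>

lemma periodic_points_on_coordinate:
  assumes "v \<in> periodic_points_on (seq_power X) (seq_power_map f)"
  shows "v n \<in> periodic_points_on X f"
  using assms
  by (force simp: periodic_points_on_def seq_power_def seq_power_map_funpow fun_eq_iff)

text \<open>The orbit never leaves \<open>S\<close>, and closedness relative to \<open>X\<close> is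
  enough because limit points lie in \<open>X\<close> by definition. Applied to the orbit of
  \<open>p\<close> in \<open>\<Lambda>\<close>.\<close>

lemma omega_limit_on_subset:
  fixes X :: "'a::t1_space set"
  assumes "closedin (top_of_set X) S" "f ` S \<subseteq> S" "x \<in> S"
  shows "omega_limit_on X f x \<subseteq> S"
proof
  fix y assume "y \<in> omega_limit_on X f x"
  then obtain i :: "nat \<Rightarrow> nat" where y: "y \<in> X" and lim: "(\<lambda>j. (f ^^ i j) x) \<longlonglongrightarrow> y"
    by (auto simp: omega_limit_on_def)
  obtain C where C: "closed C" "S = X \<inter> C"
    using assms(1) by (auto simp: closedin_closed)
  have "y \<in> C"
    using lim by (rule closed_sequentially[OF C(1), rotated])
      (use funpow_in[OF assms(2,3)] C(2) in auto)
  with y C(2) show "y \<in> S" by blast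
qed

text \<open>Describes both the starting points, with values \<open>z\<close> and \<open>p\<close>,
  and limit points of their orbits, with values \<open>y\<close> and \<open>q\<close>.\<close>

definition two_valued :: "'b set \<Rightarrow> 'a \<Rightarrow> 'a \<Rightarrow> 'b \<Rightarrow> 'a" where
  "two_valued A z p = (\<lambda>n. if n \<in> A then z else p)"

lemma omega_limit_on_two_valued:
  assumes "strict_mono i" "(\<lambda>j. (f ^^ i j) z) \<longlonglongrightarrow> y" "(\<lambda>j. (f ^^ i j) p) \<longlonglongrightarrow> q"
    and "y \<in> X" "q \<in> X"
  shows "two_valued A y q \<in> omega_limit_on (seq_power X) (seq_power_map f) (two_valued A z p)"
  using assms
  by (auto simp: omega_limit_on_def seq_power_def seq_power_map_funpow tendsto_fun_iff
      two_valued_def intro!: exI[of _ i])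

text \<open>Along the times that lead \<open>z\<close> to \<open>y\<close> the orbit of
  \<open>p\<close> may diverge. Compactness gives a subsequence along which it converges, and the
  limit \<open>y\<close> survives the thinning.\<close>

lemma omega_limit_on_two_valued_lift:
  fixes X :: "'a::metric_space set"
  assumes "compact X" "f ` X \<subseteq> X" "p \<in> X" "y \<in> omega_limit_on X f z" "n \<in> A"
  shows "\<exists>v \<in> omega_limit_on (seq_power X) (seq_power_map f) (two_valued A z p). v n = y"
proof -
  obtain i :: "nat \<Rightarrow> nat" where i: "strict_mono i" "(\<lambda>j. (f ^^ i j) z) \<longlonglongrightarrow> y" "y \<in> X"
    using assms(4) by (auto simp: omega_limit_on_def)
  have "\<forall>j. (f ^^ i j) p \<in> X"
    using funpow_in[OF assms(2,3)] by blast
  then obtain q r where q: "q \<in> X" "strict_mono r" "((\<lambda>j. (f ^^ i j) p) \<circ> r) \<longlonglongrightarrow> q"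
    using assms(1) unfolding compact_def by meson
  have "two_valued A y q \<in> omega_limit_on (seq_power X) (seq_power_map f) (two_valued A z p)"
  proof (rule omega_limit_on_two_valued)
    show "strict_mono (i \<circ> r)"
      using i(1) q(2) by (rule strict_mono_o)
    show "(\<lambda>j. (f ^^ (i \<circ> r) j) z) \<longlonglongrightarrow> y"
      using LIMSEQ_subseq_LIMSEQ[OF i(2) q(2)] by (simp add: o_def)
    show "(\<lambda>j. (f ^^ (i \<circ> r) j) p) \<longlonglongrightarrow> q"
      using q(3) by (simp add: o_def)
  qed (use i q in auto)
  moreover have "two_valued A y q n = y"
    using assms(5) by (simp add: two_valued_def)
  ultimately show ?thesis by blast
qed

text \<open>The set \<open>a c\<close> contains exactly one element of each pair
  \<open>2 * k\<close>, \<open>2 * k + 1\<close>: the even one if \<open>k\<close> is in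
  \<open>c\<close>, the odd one otherwise. An inclusion between two such selections forces
  equality.\<close>

lemma uncountable_antichain_nat:
  obtains \<A> :: "nat set set"
  where "uncountable \<A>" "\<And>A B. A \<in> \<A> \<Longrightarrow> B \<in> \<A> \<Longrightarrow> A \<noteq> B \<Longrightarrow> \<not> A \<subseteq> B"
proof
  define a :: "nat set \<Rightarrow> nat set" where "a c = {n. even n \<longleftrightarrow> n div 2 \<in> c}" for c
  have anti: "c = d" if "a c \<subseteq> a d" for c d
  proof -
    have "k \<in> c \<longleftrightarrow> k \<in> d" for k
      using subsetD[OF that, of "2 * k"] subsetD[OF that, of "2 * k + 1"]
      by (auto simp: a_def)
    then show ?thesis by blast
  qed
  have "inj a"
    by (rule injI) (simp add: anti)
  moreover have "uncountable (UNIV :: nat set set)"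
  proof
    assume "countable (UNIV :: nat set set)"
    then obtain h :: "nat \<Rightarrow> nat set" where "range h = UNIV"
      by (metis UNIV_not_empty range_from_nat_into)
    then show False
      using Cantors_theorem[of "UNIV :: nat set"] by auto
  qed
  ultimately show "uncountable (range a)"
    using countable_image_inj_on by blast
  show "\<not> A \<subseteq> B" if "A \<in> range a" "B \<in> range a" "A \<noteq> B" for A B
    using that anti by blast
qed

theorem theorem1:
  fixes X :: "'a::metric_space set" and f :: "'a \<Rightarrow> 'a"
    and \<Lambda> :: "'a set" and p z :: 'a
  assumes "compact X"
    and "continuous_on X f" and "f \<in> X \<rightarrow> X"
    and "closedin (top_of_set X) \<Lambda>" and "f ` \<Lambda> \<subseteq> \<Lambda>"
    and "p \<in> \<Lambda>" and "z \<in> X"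
    and "omega_limit_on (X \<times> X) (map_prod f f) (p, z) \<inter> {(x, y) \<in> X \<times> X. x = y} \<noteq> {}"
    and "uncountable (omega_limit_on X f z - \<Lambda>)"
    and "omega_limit_on X f z - periodic_points_on X f \<noteq> {}"
  shows "omega_chaotic_on (seq_power X) (seq_power_map f)"
proof -
  have fX: "f ` X \<subseteq> X" using assms(3) by blast
  have pX: "p \<in> X" using assms(4,6) closedin_subset by fastforce
  define L where "L A = omega_limit_on (seq_power X) (seq_power_map f) (two_valued A z p)"
    for A :: "nat set"
  have lift: "\<exists>v \<in> L A. v n = y" if "y \<in> omega_limit_on X f z" "n \<in> A" for y n A
    unfolding L_def by (rule omega_limit_on_two_valued_lift[OF assms(1) fX pX that])

  have unc: "uncountable (L A - L B)" if nA: "n \<in> A" and nB: "n \<notin> B" for n A B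
  proof
    assume "countable (L A - L B)"
    \<comment> \<open>Projecting to coordinate \<open>n\<close> transfers uncountability: each
      \<open>y\<close> outside \<open>\<Lambda>\<close> lifts to a point of \<open>L A\<close>,
      which cannot lie in \<open>L B\<close> since coordinate \<open>n\<close> starts at
      \<open>p\<close> there.\<close>
    moreover have "omega_limit_on X f z - \<Lambda> \<subseteq> (\<lambda>v. v n) ` (L A - L B)"
    proof
      fix y assume y: "y \<in> omega_limit_on X f z - \<Lambda>"
      then obtain v where v: "v \<in> L A" "v n = y"
        using lift[of y n A] nA by auto
      have "v \<notin> L B"
      proof
        assume "v \<in> L B"
        then have "v n \<in> omega_limit_on X f (two_valued B z p n)"
          unfolding L_def by (rule omega_limit_on_coordinate)
        then have "v n \<in> omega_limit_on X f p"
          using nB by (simp add: two_valued_def)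
        then show False
          using subsetD[OF omega_limit_on_subset[OF assms(4-6)]] y v(2) by auto
      qed
      with v show "y \<in> (\<lambda>v. v n) ` (L A - L B)" by blast
    qed
    ultimately show False
      using assms(9) countable_subset[OF _ countable_image] by metis
  qed

  have nonper: "L A - periodic_points_on (seq_power X) (seq_power_map f) \<noteq> {}" if nA: "n \<in> A" for n A
  proof -
    obtain y where y: "y \<in> omega_limit_on X f z" "y \<notin> periodic_points_on X f"
      using assms(10) by blast
    obtain v where v: "v \<in> L A" "v n = y"
      using lift[OF y(1) nA] by auto
    then have "v \<notin> periodic_points_on (seq_power X) (seq_power_map f)"
      using periodic_points_on_coordinate[of v X f n] y(2) by auto
    with v show ?thesis by blast
  qed

  have pow: "(map_prod f f ^^ k) (p, z) = ((f ^^ k) p, (f ^^ k) z)" for k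
    by (induction k) simp_all
  \<comment> \<open>The diagonal point in (1) supplies a single time sequence along which
    \<open>p\<close> and \<open>z\<close> approach the same \<open>w\<close>.\<close>
  obtain w and i :: "nat \<Rightarrow> nat" where w: "w \<in> X" and i: "strict_mono i"
    and lim: "(\<lambda>j. ((f ^^ i j) p, (f ^^ i j) z)) \<longlonglongrightarrow> (w, w)"
    using assms(8) by (auto simp: omega_limit_on_def pow)
  \<comment> \<open>With both values equal to \<open>w\<close>, the limit no longer depends on
    \<open>A\<close>, so all the sets \<open>L A\<close> share it.\<close>
  have "two_valued A w w \<in> L A" for A
    unfolding L_def
    using omega_limit_on_two_valued[OF i _ _ w w] tendsto_fst[OF lim] tendsto_snd[OF lim] by simp
  then have "(\<lambda>_. w) \<in> L A" for A
    by (simp add: two_valued_def)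
  then have meet: "L A \<inter> L B \<noteq> {}" for A B
    by blast

  obtain \<A> :: "nat set set" where \<A>: "uncountable \<A>"
    and anti: "\<And>A B. A \<in> \<A> \<Longrightarrow> B \<in> \<A> \<Longrightarrow> A \<noteq> B \<Longrightarrow> \<not> A \<subseteq> B"
    using uncountable_antichain_nat by blast
  define S where "S = (\<lambda>A. two_valued A z p) ` \<A>"
  \<comment> \<open>If two index sets gave the same point, \<open>L A - L B\<close> would be empty,
    against \<open>unc\<close>.\<close>
  have "inj_on (\<lambda>A. two_valued A z p) \<A>"
  proof (rule inj_onI, rule ccontr)
    fix A B assume AB: "A \<in> \<A>" "B \<in> \<A>" "two_valued A z p = two_valued B z p" "A \<noteq> B"
    then obtain n where "n \<in> A" "n \<notin> B"
      using anti[of A B] by blast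
    then have "uncountable (L A - L B)"
      by (rule unc)
    with AB(3) show False by (simp add: L_def)
  qed
  then have "uncountable S"
    unfolding S_def using \<A> countable_image_inj_on by blast
  moreover have "omega_scrambled_on (seq_power X) (seq_power_map f) S"
    unfolding omega_scrambled_on_def
  proof (intro conjI[of "S \<subseteq> seq_power X"] ballI impI)
    show "S \<subseteq> seq_power X"
      using pX assms(7) by (auto simp: S_def seq_power_def two_valued_def)
    fix x y assume "x \<in> S" "y \<in> S" "x \<noteq> y"
    then obtain A B where AB: "A \<in> \<A>" "B \<in> \<A>" "A \<noteq> B"
      and xy: "x = two_valued A z p" "y = two_valued B z p"
      by (auto simp: S_def)
    \<comment> \<open>This one index yields both the uncountable difference and, as a member of
      \<open>A\<close>, the limit point that is not periodic.\<close>
    obtain n where n: "n \<in> A" "n \<notin> B"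
      using anti[OF AB] by blast
    show "uncountable (omega_limit_on (seq_power X) (seq_power_map f) x -
          omega_limit_on (seq_power X) (seq_power_map f) y) \<and>
        omega_limit_on (seq_power X) (seq_power_map f) x \<inter>
          omega_limit_on (seq_power X) (seq_power_map f) y \<noteq> {} \<and>
        omega_limit_on (seq_power X) (seq_power_map f) x -
          periodic_points_on (seq_power X) (seq_power_map f) \<noteq> {}"
      using unc[OF n] meet[of A B] nonper[OF n(1)] unfolding xy L_def by (intro conjI)
  qed
  ultimately show ?thesis
    unfolding omega_chaotic_on_def by blast
qed

end
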